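(* Let $n$ be a positive integer and $\delta$ a real number. Then, as polynomials in $x,y$, $$T_n(x)^2-2T_n(x)T_n(y)\cos\delta+T_n(y)^2-\sin^2\delta=4^{n-1}\prod_{k=1}^{n}\Big(x^2-2\cos\frac{\delta+2k\pi}{n}\,xy+y^2-\sin^2\frac{\delta+2k\pi}{n}\Big).$$
   Context: For a nonnegative integer $k$, $T_k$ denotes the $k$-th Chebyshev polynomial of the first kind, i.e. the unique polynomial with $T_k(\cos\theta)=\cos k\theta$ for all real $\theta$. *)

theory Defs
  imports Complex_Main "HOL-Computational_Algebra.Polynomial"
begin

definition chebyshev :: "nat \<Rightarrow> real poly" where
  "chebyshev k = (THE p. \<forall>\<theta>. poly p (cos \<theta>) = cos (real k * \<theta>))"

lemma chebyshev_exists: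
  "\<exists>p :: real poly. \<forall>\<theta>. poly p (cos \<theta>) = cos (real k * \<theta>)"
proof (induction k rule: induct_nat_012)
  case 0
  show ?case by (rule exI[of _ 1]) simp
next
  case 1
  show ?case by (rule exI[of _ "[:0, 1:]"]) simp
next
  case (ge2 k)
  then obtain p q :: "real poly"
    where p: "\<And>\<theta>. poly p (cos \<theta>) = cos (real k * \<theta>)"
      and q: "\<And>\<theta>. poly q (cos \<theta>) = cos (real (Suc k) * \<theta>)"
    by blast
  have "poly ([:0, 2:] * q - p) (cos \<theta>) = cos (real (Suc (Suc k)) * \<theta>)" for \<theta> :: real
  proof -
    define a where "a = real (Suc k) * \<theta>"
    have "real k * \<theta> = a - \<theta>" "real (Suc (Suc k)) * \<theta> = a + \<theta>"
      by (simp_all add: a_def algebra_simps)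
    then have "poly p (cos \<theta>) = cos (a - \<theta>)" "poly q (cos \<theta>) = cos a"
      "cos (real (Suc (Suc k)) * \<theta>) = cos (a + \<theta>)"
      using p[of \<theta>] q[of \<theta>] by (simp_all only: a_def)
    then show ?thesis by (simp add: cos_add cos_diff del: of_nat_Suc)
  qed
  then show ?case by blast
qed

lemma chebyshev_unique:
  fixes p q :: "real poly"
  assumes "\<And>\<theta>. poly p (cos \<theta>) = cos (real k * \<theta>)"
    and "\<And>\<theta>. poly q (cos \<theta>) = cos (real k * \<theta>)"
  shows "p = q"
proof (rule ccontr)
  assume "p \<noteq> q"
  then have "finite {x. poly (p - q) x = 0}"
    by (intro poly_roots_finite) simp
  moreover have "{-1..1} \<subseteq> {x. poly (p - q) x = 0}"
  proof
    fix x :: real assume "x \<in> {-1..1}"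
    then have "x = cos (arccos x)" by simp
    then have "poly p x = poly q x" using assms by metis
    then show "x \<in> {x. poly (p - q) x = 0}" by simp
  qed
  ultimately have "finite {-1..1::real}" by (rule rev_finite_subset)
  then show False by (simp add: infinite_Icc)
qed

lemma poly_chebyshev_cos: "poly (chebyshev k) (cos \<theta>) = cos (real k * \<theta>)"
proof -
  have "\<exists>!p :: real poly. \<forall>\<theta>. poly p (cos \<theta>) = cos (real k * \<theta>)"
    using chebyshev_exists chebyshev_unique by (intro ex_ex1I) blast+
  from theI'[OF this] show ?thesis unfolding chebyshev_def by blast
qed

text \<open>
  The ring of polynomials over the reals in two indeterminates x and y is represented as
  real poly poly: the inner indeterminate is x and the outer one is y.
\<close>

definition const2 :: "real \<Rightarrow> real poly poly" where
  "const2 c = [:[:c:]:]"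

definition X :: "real poly poly" where
  "X = [:[:0, 1:]:]"

definition Y :: "real poly poly" where
  "Y = [:0, 1:]"

text \<open>Substitution of a bivariate polynomial for the indeterminate of a univariate one.\<close>

definition subst2 :: "real poly \<Rightarrow> real poly poly \<Rightarrow> real poly poly" where
  "subst2 p z = poly (map_poly const2 p) z"

end

theory Submission
  imports Defs
begin

text \<open>
  It suffices to compare values at \<open>x = cos a\<close>, \<open>y = cos b\<close>, where both the left-hand
  side and each factor on the right have the shape
  \<open>cos\<^sup>2 A - 2 cos A cos B cos \<phi> + cos\<^sup>2 B - sin\<^sup>2 \<phi> = (cos (A + B) - cos \<phi>) (cos (A - B) - cos \<phi>)\<close>.
  Hence the identity is the product of two instances, \<open>u = a + b\<close> and \<open>u = a - b\<close>, of
  \<open>cos n u - cos \<delta> = 2\<^bsup>n - 1\<^esup> \<Prod>\<^sub>k (cos u - cos ((\<delta> + 2 k \<pi>) / n))\<close>, which follows from the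
  factorization of \<open>z\<^sup>n - e\<^bsup>i\<delta>\<^esup>\<close> at \<open>z = e\<^bsup>iu\<^esup>\<close>.
\<close>

text \<open>As polynomials in \<open>z\<close>, both sides are monic of degree \<open>n\<close> and
  vanish at the points \<open>r k\<close>. These are the \<open>n\<close>-th roots of unity scaled
  by \<open>w\<close>, hence \<open>n\<close> distinct points since \<open>w\<close> is
  nonzero.\<close>

lemma diff_power_eq_prod_roots:
  fixes z w :: complex
  assumes "n > 0" and "w \<noteq> 0"
  shows "z ^ n - w ^ n = (\<Prod>k = 1..n. z - w * cis (2 * real k * pi / real n))"
proof -
  define r where "r k = w * cis (2 * real k * pi / real n)" for k
  \<comment> \<open>The library enumerates roots of unity by \<open>k < n\<close>; periodicity lets
    index \<open>n\<close> stand in for index \<open>0\<close>.\<close>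
  have shift: "(\<Prod>k = 1..n. z - r k) = (\<Prod>k<n. z - r k)"
  proof -
    have "r n = r 0" using assms by (simp add: r_def cis_2pi)
    moreover have "{1..n} = insert n {1..<n}" "{..<n} = insert 0 {1..<n}"
      using assms by auto
    ultimately show ?thesis by simp
  qed
  have inj: "inj_on r {..<n}"
    using bij_betw_roots_unity[OF assms(1)] assms(2)
    by (simp add: r_def inj_on_def bij_betw_def mult_ac)
  have pow: "r k ^ n = w ^ n" for k
  proof -
    have "r k ^ n = w ^ n * cis (2 * pi * real k)"
      using assms by (simp add: r_def power_mult_distrib Complex.DeMoivre mult_ac)
    then show ?thesis by (simp add: cis_multiple_2pi)
  qed
  define P where "P = monom 1 n - [:w ^ n:]"
  define Q where "Q = (\<Prod>k<n. [:- r k, 1:])"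
  have degP: "degree P \<le> n"
    unfolding P_def by (intro degree_diff_le degree_monom_le) simp
  have leadP: "coeff P n = 1"
    using assms by (simp add: P_def coeff_pCons split: nat.split)
  have degQ: "degree Q = n"
    unfolding Q_def by (simp add: degree_prod_eq_sum_degree)
  have leadQ: "coeff Q n = 1"
    using lead_coeff_prod[of "\<lambda>k. [:- r k, 1:]" "{..<n}"] degQ by (simp add: Q_def)
  have "P = Q"
  \<comment> \<open>Equal leading coefficients cancel in the difference, so \<open>n\<close> points
    of agreement suffice.\<close>
  proof (rule poly_eqI_degree_lead_coeff[where n = n and A = "r ` {..<n}"])
    show "card (r ` {..<n}) \<ge> n" using inj by (simp add: card_image)
    show "poly P x = poly Q x" if "x \<in> r ` {..<n}" for x
      using that pow by (auto simp: P_def Q_def poly_monom poly_prod)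
  qed (simp_all add: degP degQ leadP leadQ)
  then have "poly P z = poly Q z" by simp
  then show ?thesis
    using shift by (simp add: P_def Q_def poly_monom poly_prod r_def)
qed

text \<open>Pairing conjugate roots gives \<open>(cis u)^2 - 2 * cos \<phi> * cis u + 1\<close>;
  factor out \<open>cis u\<close> and use \<open>cis u + cis (- u) = 2 * cos u\<close>.\<close>

lemma cis_diff_mult_eq_cos_diff:
  "(cis u - cis \<phi>) * (cis u - cis (- \<phi>)) = cis u * of_real (2 * (cos u - cos \<phi>))"
  by (simp add: complex_eq_iff algebra_simps)

lemma cos_diff_eq_prod:
  assumes "n > 0"
  shows "cos (real n * u) - cos \<delta> =
    2 ^ (n - 1) * (\<Prod>k = 1..n. cos u - cos ((\<delta> + 2 * real k * pi) / real n))"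
proof -
  define \<phi> where "\<phi> k = (\<delta> + 2 * real k * pi) / real n" for k
  have split: "cis (real n * u) - cis \<delta> = (\<Prod>k = 1..n. cis u - cis (\<phi> k))" for u
    using diff_power_eq_prod_roots[OF assms, of "cis (\<delta> / real n)" "cis u"] assms
    by (simp add: \<phi>_def Complex.DeMoivre cis_mult add_divide_distrib)
  \<comment> \<open>Conjugation at \<open>- u\<close> restores \<open>cis u\<close> but negates the
    angles of the roots.\<close>
  have split_cnj: "cis (real n * u) - cis (- \<delta>) = (\<Prod>k = 1..n. cis u - cis (- \<phi> k))"
    using arg_cong[OF split[of "- u"], of cnj] by (simp add: cis_cnj)
  have "cis (real n * u) * of_real (2 * (cos (real n * u) - cos \<delta>))
      = (\<Prod>k = 1..n. cis u * of_real (2 * (cos u - cos (\<phi> k))))"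
    unfolding cis_diff_mult_eq_cos_diff[symmetric] split split_cnj prod.distrib ..
  also have "\<dots> = cis (real n * u) * of_real (2 ^ n * (\<Prod>k = 1..n. cos u - cos (\<phi> k)))"
    by (simp add: prod.distrib Complex.DeMoivre del: right_diff_distrib_numeral of_real_diff)
  finally have "2 * (cos (real n * u) - cos \<delta>) = 2 ^ n * (\<Prod>k = 1..n. cos u - cos (\<phi> k))"
    by (simp only: mult_cancel_left cis_neq_zero of_real_eq_iff simp_thms)
  then show ?thesis
    using assms by (simp add: \<phi>_def power_eq_if)
qed

lemma cos_factorization:
  fixes A B \<phi> :: real
  shows "(cos A)\<^sup>2 - 2 * cos A * cos B * cos \<phi> + (cos B)\<^sup>2 - (sin \<phi>)\<^sup>2
    = (cos (A + B) - cos \<phi>) * (cos (A - B) - cos \<phi>)"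
  unfolding cos_add cos_diff
  using sin_cos_squared_add[of A] sin_cos_squared_add[of B] sin_cos_squared_add[of \<phi>]
  by algebra

lemma poly_eqI_infinite:
  fixes p q :: "'a :: idom poly"
  assumes "infinite A" and "\<And>x. x \<in> A \<Longrightarrow> poly p x = poly q x"
  shows "p = q"
proof (rule ccontr)
  assume "p \<noteq> q"
  then have "finite {x. poly (p - q) x = 0}" by (intro poly_roots_finite) simp
  moreover have "A \<subseteq> {x. poly (p - q) x = 0}" using assms(2) by auto
  ultimately show False using assms(1) finite_subset by blast
qed

text \<open>Cosine takes infinitely many values, so the univariate identity principle applies twice:
  in x over the reals for each fixed \<open>b\<close>, then in y over the integral domain
  \<open>real poly\<close>, at constant polynomials.\<close>

lemma poly2_eqI_cos:
  fixes P Q :: "real poly poly"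
  assumes "\<And>a b. poly (poly P [:cos b:]) (cos a) = poly (poly Q [:cos b:]) (cos a)"
  shows "P = Q"
proof -
  have inf: "infinite (range (cos :: real \<Rightarrow> real))"
  proof -
    have "{-1..1} \<subseteq> range (cos :: real \<Rightarrow> real)"
      using cos_arccos by (metis atLeastAtMost_iff rangeI subsetI)
    moreover have "infinite {-1..1::real}" by (simp add: infinite_Icc)
    ultimately show ?thesis using finite_subset by blast
  qed
  have "poly P [:cos b:] = poly Q [:cos b:]" for b
    using assms inf by (intro poly_eqI_infinite[of "range cos"]) auto
  moreover have "infinite ((\<lambda>c. [:c:]) ` range (cos :: real \<Rightarrow> real))"
    using inf by (subst finite_image_iff) (auto simp: inj_on_def)
  ultimately show ?thesis
    by (intro poly_eqI_infinite[of "(\<lambda>c. [:c:]) ` range cos"]) auto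
qed

text \<open>Evaluation at a point is a ring homomorphism fixing constants, so it commutes with
  substitution.\<close>

lemma poly_poly_subst2: "poly (poly (subst2 p z) [:y:]) x = poly p (poly (poly z [:y:]) x)"
proof (induction p)
  case 0
  then show ?case by (simp add: subst2_def)
next
  case (pCons a p)
  then show ?case by (simp add: subst2_def map_poly_pCons const2_def)
qed

theorem theorem1:
  fixes n :: nat and \<delta> :: real
  assumes "n \<ge> 1"
  shows "(subst2 (chebyshev n) X)\<^sup>2
           - 2 * subst2 (chebyshev n) X * subst2 (chebyshev n) Y * const2 (cos \<delta>)
           + (subst2 (chebyshev n) Y)\<^sup>2 - const2 ((sin \<delta>)\<^sup>2)
         = 4 ^ (n - 1) *
           (\<Prod>k = 1..n. X\<^sup>2
              - const2 (2 * cos ((\<delta> + 2 * real k * pi) / real n)) * X * Y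
              + Y\<^sup>2 - const2 ((sin ((\<delta> + 2 * real k * pi) / real n))\<^sup>2))"
proof (rule poly2_eqI_cos)
  fix a b :: real
  define \<phi> where "\<phi> k = (\<delta> + 2 * real k * pi) / real n" for k
  have n: "n > 0" using assms by simp
  have XY: "poly (poly X [:cos b:]) (cos a) = cos a" "poly (poly Y [:cos b:]) (cos a) = cos b"
    by (simp_all add: X_def Y_def)
  have T: "poly (poly (subst2 (chebyshev n) X) [:cos b:]) (cos a) = cos (real n * a)"
    "poly (poly (subst2 (chebyshev n) Y) [:cos b:]) (cos a) = cos (real n * b)"
    by (simp_all add: poly_poly_subst2 poly_chebyshev_cos XY)
  have "(cos (real n * a))\<^sup>2 - 2 * cos (real n * a) * cos (real n * b) * cos \<delta>
      + (cos (real n * b))\<^sup>2 - (sin \<delta>)\<^sup>2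
    = (cos (real n * (a + b)) - cos \<delta>) * (cos (real n * (a - b)) - cos \<delta>)"
    by (simp only: cos_factorization distrib_left right_diff_distrib)
  also have "\<dots> = 4 ^ (n - 1) *
      (\<Prod>k = 1..n. (cos (a + b) - cos (\<phi> k)) * (cos (a - b) - cos (\<phi> k)))"
    \<comment> \<open>Each of the two instances contributes a factor \<open>2 ^ (n - 1)\<close>,
      whence \<open>4 ^ (n - 1)\<close>.\<close>
    by (simp add: cos_diff_eq_prod[OF n] prod.distrib \<phi>_def flip: power_mult_distrib)
  also have "\<dots> = 4 ^ (n - 1) * (\<Prod>k = 1..n. (cos a)\<^sup>2 - 2 * cos (\<phi> k) * cos a * cos b
      + (cos b)\<^sup>2 - (sin (\<phi> k))\<^sup>2)"
    unfolding cos_factorization[symmetric] by (simp add: mult_ac)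
  finally show "poly (poly ((subst2 (chebyshev n) X)\<^sup>2
           - 2 * subst2 (chebyshev n) X * subst2 (chebyshev n) Y * const2 (cos \<delta>)
           + (subst2 (chebyshev n) Y)\<^sup>2 - const2 ((sin \<delta>)\<^sup>2)) [:cos b:]) (cos a)
    = poly (poly (4 ^ (n - 1) *
           (\<Prod>k = 1..n. X\<^sup>2
              - const2 (2 * cos ((\<delta> + 2 * real k * pi) / real n)) * X * Y
              + Y\<^sup>2 - const2 ((sin ((\<delta> + 2 * real k * pi) / real n))\<^sup>2))) [:cos b:]) (cos a)"
    by (simp add: T XY poly_prod const2_def \<phi>_def mult_ac)
qed

end
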